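(* The variety of J\'onsson-Tarski algebras does not contain J\'onsson algebras of cardinality greater than $\aleph_1$.
   Context: A J\'onsson-Tarski algebra is an algebra $A$ with one binary operation $\cdot$ and two unary operations $\ell$ and $r$ satisfying the identities $\ell(x\cdot y)=x$, $r(x\cdot y)=y$, and $\ell(z)\cdot r(z)=z$. A J\'onsson algebra is an infinite algebra $J$, in a countable algebraic language (finitary operations), which has no proper subalgebras of the same cardinality as $J$. *)

theory Defs
  imports Main "HOL-Library.Countable_Set"
begin

unbundle cardinal_syntax

abbreviation aleph_one :: "nat set rel" where
  "aleph_one \<equiv> cardSuc natLeq"

text \<open>
  A finitary language is a set \<open>F\<close> of operation symbols with an arity function \<open>ar\<close>. An interpretation
  \<open>I\<close> assigns to each symbol an operation on lists, of which only the values on lists of length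
  \<open>ar f\<close> with entries in the universe are relevant.
\<close>

definition closed_under_ops ::
  "'f set \<Rightarrow> ('f \<Rightarrow> nat) \<Rightarrow> ('f \<Rightarrow> 'a list \<Rightarrow> 'a) \<Rightarrow> 'a set \<Rightarrow> bool" where
  "closed_under_ops F ar I B \<longleftrightarrow>
    (\<forall>f\<in>F. \<forall>xs\<in>lists B. length xs = ar f \<longrightarrow> I f xs \<in> B)"

definition is_algebra ::
  "'f set \<Rightarrow> ('f \<Rightarrow> nat) \<Rightarrow> 'a set \<Rightarrow> ('f \<Rightarrow> 'a list \<Rightarrow> 'a) \<Rightarrow> bool" where
  "is_algebra F ar A I \<longleftrightarrow> closed_under_ops F ar I A"

definition is_subalgebra ::
  "'f set \<Rightarrow> ('f \<Rightarrow> nat) \<Rightarrow> 'a set \<Rightarrow> ('f \<Rightarrow> 'a list \<Rightarrow> 'a) \<Rightarrow> 'a set \<Rightarrow> bool" where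
  "is_subalgebra F ar A I B \<longleftrightarrow> B \<subseteq> A \<and> closed_under_ops F ar I B"

definition jonsson_algebra ::
  "'f set \<Rightarrow> ('f \<Rightarrow> nat) \<Rightarrow> 'a set \<Rightarrow> ('f \<Rightarrow> 'a list \<Rightarrow> 'a) \<Rightarrow> bool" where
  "jonsson_algebra F ar A I \<longleftrightarrow>
    countable F \<and> is_algebra F ar A I \<and> infinite A \<and>
    \<not> (\<exists>B. is_subalgebra F ar A I B \<and> B \<noteq> A \<and> |B| =o |A| )"

datatype jt_op = JT_mult | JT_left | JT_right

fun jt_arity :: "jt_op \<Rightarrow> nat" where
  "jt_arity JT_mult = 2"
| "jt_arity JT_left = 1"
| "jt_arity JT_right = 1"

definition jonsson_tarski_algebra :: "'a set \<Rightarrow> (jt_op \<Rightarrow> 'a list \<Rightarrow> 'a) \<Rightarrow> bool" where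
  "jonsson_tarski_algebra A I \<longleftrightarrow>
    is_algebra UNIV jt_arity A I \<and>
    (\<forall>x\<in>A. \<forall>y\<in>A. I JT_left [I JT_mult [x, y]] = x) \<and>
    (\<forall>x\<in>A. \<forall>y\<in>A. I JT_right [I JT_mult [x, y]] = y) \<and>
    (\<forall>z\<in>A. I JT_mult [I JT_left [z], I JT_right [z]] = z)"

end

theory Submission imports Defs "HOL-Library.Countable_Set_Type" begin

text \<open>
  Suppose that \<open>A\<close> is a Jonsson-Tarski algebra that is also a Jonsson algebra and that
  \<open>|A| > \<aleph>\<^sub>1\<close>; write \<open>\<langle>X\<rangle>\<close> for the subalgebra generated by \<open>X\<close>. Well-order \<open>A\<close>, and let \<open>K\<close>
  consist of those \<open>b\<close> that are not generated by their predecessors. Then \<open>K\<close> generates \<open>A\<close>,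
  so \<open>|K| > \<aleph>\<^sub>1\<close>. For \<open>b \<in> K\<close> let \<open>S\<^sub>b\<close> be a subalgebra that contains all predecessors
  of \<open>b\<close> and is maximal for not containing \<open>b\<close>. As \<open>A\<close> is a Jonsson algebra,
  \<open>|S\<^sub>b| < |A|\<close>.

  The sets \<open>\<langle>b\<rangle> - S\<^sub>b\<close>, for \<open>b \<in> K\<close>, are pairwise disjoint, because \<open>b < c\<close> gives
  \<open>\<langle>b\<rangle> \<subseteq> S\<^sub>c\<close>. The Jonsson-Tarski identities enter through a normal form: the operations
  \<open>\<ell>\<close> and \<open>r\<close> can be pushed through products, so the members of a generated subalgebra are
  iterated products of unary images of generators, and the factors can be recovered from the
  product. If \<open>x \<notin> S\<^sub>b\<close>, then \<open>b\<close> is generated by \<open>S\<^sub>b \<union> {x}\<close>, so it is an iterated product of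
  factors from \<open>S\<^sub>b\<close> and \<open>\<langle>x\<rangle>\<close>. All factors lie in \<open>\<langle>b\<rangle>\<close>, and not all of them lie in \<open>S\<^sub>b\<close>;
  so \<open>\<langle>x\<rangle>\<close> meets \<open>\<langle>b\<rangle> - S\<^sub>b\<close> (lemma \<open>jt_gen_meets_outside\<close>). Since \<open>\<langle>x\<rangle>\<close> is
  countable, every \<open>x\<close> is missing from only countably many of the sets \<open>S\<^sub>b\<close>.

  This contradicts a purely set-theoretic fact (lemma \<open>point_missing_from_uncountably_many\<close>):
  as \<open>|A| > \<aleph>\<^sub>1\<close>, any family of more than \<open>\<aleph>\<^sub>1\<close> sets, each smaller than \<open>A\<close>, includes
  uncountably many that miss a common point of \<open>A\<close>.
\<close>

section \<open>Families of small sets\<close>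

lemma Card_order_aleph_one: "Card_order aleph_one"
  by (simp add: cardSuc_Card_order natLeq_Card_order)

lemma infinite_Field_aleph_one: "infinite (Field aleph_one)"
  unfolding cardSuc_finite[OF natLeq_Card_order] Field_natLeq by (rule infinite_UNIV_nat)

lemma uncountable_aleph_one_subset:
  assumes "uncountable N"
  obtains L where "L \<subseteq> N" "uncountable L" "|L| \<le>o aleph_one"
proof -
  have "\<not> |N| \<le>o natLeq"
    using assms by (simp add: countable_card_le_natLeq)
  then have "natLeq <o |N|"
    using not_ordLeq_iff_ordLess[OF natLeq_Well_order card_of_Well_order] by blast
  then have "aleph_one \<le>o |N|"
    by (rule cardSuc_least[OF natLeq_Card_order card_of_Card_order])
  then have "|Field aleph_one| \<le>o |N|"
    using card_of_Field_ordIso[OF Card_order_aleph_one] ordIso_ordLeq_trans by blast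
  then obtain f where f: "inj_on f (Field aleph_one)" "f ` Field aleph_one \<subseteq> N"
    using card_of_ordLeq[of "Field aleph_one" N] by blast
  have "natLeq <o aleph_one"
    by (simp add: cardSuc_greater natLeq_Card_order)
  then have "\<not> |Field aleph_one| \<le>o natLeq"
    using card_of_Field_ordIso[OF Card_order_aleph_one] ordIso_symmetric ordLess_ordIso_trans not_ordLess_ordLeq
    by blast
  then have unc: "uncountable (f ` Field aleph_one)"
    using f(1) countable_card_le_natLeq countable_image_inj_on by blast
  have le: "|f ` Field aleph_one| \<le>o aleph_one"
    using card_of_image card_of_Field_ordIso[OF Card_order_aleph_one] ordLeq_ordIso_trans by blast
  show thesis
    by (rule that[OF f(2) unc le])
qed

text \<open>
  Order the indices by the cardinality of their sets. Uncountably many indices below a fixed one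
  would include \<open>\<aleph>\<^sub>1\<close> of them, and the union of their sets would be smaller than \<open>A\<close>, because a
  single cardinal below \<open>|A|\<close> bounds the sizes; a point of \<open>A\<close> outside this union is missing
  from uncountably many sets. Otherwise all initial segments are countable, and a linear
  preorder with this property has at most \<open>\<aleph>\<^sub>1\<close> elements. Comparing cardinalities in this way
  treats regular and singular \<open>|A|\<close> alike.
\<close>

lemma point_missing_from_uncountably_many:
  fixes S :: "'k \<Rightarrow> 'a set"
  assumes A: "aleph_one <o |A|" and K: "aleph_one <o |K|"
    and small: "\<And>b. b \<in> K \<Longrightarrow> |S b| <o |A|"
  obtains x where "x \<in> A" "uncountable {b \<in> K. x \<notin> S b}"
proof -
  have natA: "natLeq <o aleph_one"
    by (simp add: cardSuc_greater natLeq_Card_order)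
  have uncK: "uncountable K"
    using ordLess_transitive[OF natA K] countable_card_le_natLeq not_ordLess_ordLeq by blast
  have infA: "infinite A"
    using ordLess_transitive[OF natA A] countable_card_le_natLeq not_ordLess_ordLeq
      countable_finite by blast
  define N where "N c = {b \<in> K. |S b| \<le>o |S c| }" for c
  show thesis
  proof (cases "\<exists>c\<in>K. uncountable (N c)")
    case True
    then obtain c where c: "c \<in> K" "uncountable (N c)" by blast
    obtain L where L: "L \<subseteq> N c" "uncountable L" "|L| \<le>o aleph_one"
      using uncountable_aleph_one_subset[OF c(2)] by blast
    have LA: "|L| <o |A|"
      using L(3) A ordLeq_ordLess_trans by blast
    have infL: "infinite L"
      using L(2) countable_finite by blast
    have "|\<Union>b\<in>L. S b| \<le>o |L <+> S c|"
    proof (rule card_of_UNION_ordLeq_infinite)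
      show "infinite (L <+> S c)" using infL by simp
      show "|L| \<le>o |L <+> S c|" by (rule card_of_Plus1)
      show "\<forall>b\<in>L. |S b| \<le>o |L <+> S c|"
        using L(1) card_of_Plus2[of "S c" L] ordLeq_transitive unfolding N_def by blast
    qed
    moreover have "|L <+> S c| <o |A|"
      by (rule card_of_Plus_ordLess_infinite[OF infA LA small[OF c(1)]])
    ultimately have "|\<Union>b\<in>L. S b| <o |A|"
      using ordLeq_ordLess_trans by blast
    then have "\<not> A \<subseteq> (\<Union>b\<in>L. S b)"
      using card_of_mono1 not_ordLess_ordLeq by blast
    then obtain x where x: "x \<in> A" "\<forall>b\<in>L. x \<notin> S b" by blast
    have "L \<subseteq> {b \<in> K. x \<notin> S b}"
      using L(1) x(2) unfolding N_def by blast
    then have "uncountable {b \<in> K. x \<notin> S b}"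
      using L(2) countable_subset by blast
    then show thesis using that x(1) by blast
  next
    case False
    obtain L where L: "L \<subseteq> K" "uncountable L" "|L| \<le>o aleph_one"
      using uncountable_aleph_one_subset[OF uncK] by blast
    \<comment> \<open>An uncountable set is not contained in a countable initial segment, so \<open>L\<close> is cofinal.\<close>
    have "K \<subseteq> (\<Union>b\<in>L. N b)"
    proof
      fix c assume c: "c \<in> K"
      then have "countable (N c)"
        using False by blast
      then have "\<not> L \<subseteq> N c"
        using L(2) countable_subset[of L "N c"] by blast
      then obtain b where b: "b \<in> L" "\<not> |S b| \<le>o |S c|"
        using L(1) unfolding N_def by blast
      then have "|S c| \<le>o |S b|"
        using ordLeq_total card_of_Well_order by blast
      then show "c \<in> (\<Union>b\<in>L. N b)"
        using b(1) c unfolding N_def by blast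
    qed
    moreover have "|\<Union>b\<in>L. N b| \<le>o aleph_one"
    proof (rule card_of_UNION_ordLeq_infinite_Field)
      show "infinite (Field aleph_one)" by (rule infinite_Field_aleph_one)
      show "\<forall>b\<in>L. |N b| \<le>o aleph_one"
      proof
        fix b assume "b \<in> L"
        then have "countable (N b)"
          using False L(1) by blast
        then have "|N b| \<le>o natLeq"
          by (simp add: countable_card_le_natLeq)
        then show "|N b| \<le>o aleph_one"
          using ordLess_imp_ordLeq[OF natA] ordLeq_transitive by blast
      qed
    qed (use Card_order_aleph_one L(3) in auto)
    ultimately have "|K| \<le>o aleph_one"
      using card_of_mono1 ordLeq_transitive by blast
    then show thesis
      using K not_ordLess_ordLeq by blast
  qed
qed

section \<open>Generated subalgebras\<close>

lemma closed_under_jt_ops_iff: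
  "closed_under_ops UNIV jt_arity I B \<longleftrightarrow>
    (\<forall>x\<in>B. \<forall>y\<in>B. I JT_mult [x, y] \<in> B) \<and>
    (\<forall>x\<in>B. I JT_left [x] \<in> B) \<and> (\<forall>x\<in>B. I JT_right [x] \<in> B)"
  (is "?C \<longleftrightarrow> ?R")
proof
  assume C: ?C
  have op: "I f xs \<in> B" if "set xs \<subseteq> B" "length xs = jt_arity f" for f xs
    using C that unfolding closed_under_ops_def by (auto simp: in_lists_conv_set)
  show ?R
    by (auto intro!: op)
next
  assume R: ?R
  have "I f xs \<in> B" if "set xs \<subseteq> B" "length xs = jt_arity f" for f xs
    using R that
    by (cases f) (auto simp: length_Suc_conv numeral_2_eq_2)
  then show ?C
    unfolding closed_under_ops_def by (auto simp: in_lists_conv_set subset_iff)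
qed

inductive_set jt_gen :: "(jt_op \<Rightarrow> 'a list \<Rightarrow> 'a) \<Rightarrow> 'a set \<Rightarrow> 'a set"
  for I :: "jt_op \<Rightarrow> 'a list \<Rightarrow> 'a" and X :: "'a set" where
  base: "x \<in> X \<Longrightarrow> x \<in> jt_gen I X"
| mult: "x \<in> jt_gen I X \<Longrightarrow> y \<in> jt_gen I X \<Longrightarrow> I JT_mult [x, y] \<in> jt_gen I X"
| left: "x \<in> jt_gen I X \<Longrightarrow> I JT_left [x] \<in> jt_gen I X"
| right: "x \<in> jt_gen I X \<Longrightarrow> I JT_right [x] \<in> jt_gen I X"

lemma closed_jt_gen: "closed_under_ops UNIV jt_arity I (jt_gen I X)"
  unfolding closed_under_jt_ops_iff by (auto intro: jt_gen.intros)

lemma jt_gen_least: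
  assumes "X \<subseteq> B" "closed_under_ops UNIV jt_arity I B"
  shows "jt_gen I X \<subseteq> B"
proof
  fix z assume "z \<in> jt_gen I X"
  then show "z \<in> B"
    using assms unfolding closed_under_jt_ops_iff by induction auto
qed

lemma jt_gen_mono: "X \<subseteq> Y \<Longrightarrow> jt_gen I X \<subseteq> jt_gen I Y"
  by (rule jt_gen_least[OF _ closed_jt_gen]) (auto intro: jt_gen.base)

primrec jt_stage :: "(jt_op \<Rightarrow> 'a list \<Rightarrow> 'a) \<Rightarrow> 'a set \<Rightarrow> nat \<Rightarrow> 'a set" where
  "jt_stage I X 0 = X"
| "jt_stage I X (Suc n) = jt_stage I X n \<union>
    (\<lambda>(x, y). I JT_mult [x, y]) ` (jt_stage I X n \<times> jt_stage I X n) \<union>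
    (\<lambda>x. I JT_left [x]) ` jt_stage I X n \<union> (\<lambda>x. I JT_right [x]) ` jt_stage I X n"

lemma jt_gen_subset_stages: "jt_gen I X \<subseteq> (\<Union>n. jt_stage I X n)"
proof (rule jt_gen_least)
  show "X \<subseteq> (\<Union>n. jt_stage I X n)"
    using UN_upper[of 0 UNIV "jt_stage I X"] by simp
  have "jt_stage I X n \<subseteq> jt_stage I X (Suc n)" for n
    by (simp add: Un_assoc)
  then have mono: "jt_stage I X m \<subseteq> jt_stage I X n" if "m \<le> n" for m n
    using lift_Suc_mono_le[of "jt_stage I X" m n] that by blast
  have common: "\<exists>k. x \<in> jt_stage I X k \<and> y \<in> jt_stage I X k"
    if "x \<in> jt_stage I X m" "y \<in> jt_stage I X n" for x y m n
    using that mono[of m "max m n"] mono[of n "max m n"] max.cobounded1[of m n]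
      max.cobounded2[of n m] by blast
  show "closed_under_ops UNIV jt_arity I (\<Union>n. jt_stage I X n)"
    unfolding closed_under_jt_ops_iff
  proof (intro conjI ballI)
    fix x y assume "x \<in> (\<Union>n. jt_stage I X n)" "y \<in> (\<Union>n. jt_stage I X n)"
    then obtain k where "x \<in> jt_stage I X k" "y \<in> jt_stage I X k"
      using common by blast
    then have "I JT_mult [x, y] \<in> jt_stage I X (Suc k)" by force
    then show "I JT_mult [x, y] \<in> (\<Union>n. jt_stage I X n)" by blast
  next
    fix x assume "x \<in> (\<Union>n. jt_stage I X n)"
    then obtain k where k: "x \<in> jt_stage I X k" by blast
    then have "I JT_left [x] \<in> jt_stage I X (Suc k)" by simp
    then show "I JT_left [x] \<in> (\<Union>n. jt_stage I X n)" by blast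
    from k have "I JT_right [x] \<in> jt_stage I X (Suc k)" by simp
    then show "I JT_right [x] \<in> (\<Union>n. jt_stage I X n)" by blast
  qed
qed

text \<open>
  There are three operations and countably many stages, and no stage exceeds an infinite
  cardinal that bounds the generating set.
\<close>

lemma card_of_jt_gen_le:
  assumes X: "|X| \<le>o r" and r: "Card_order r" "infinite (Field r)"
  shows "|jt_gen I X| \<le>o r"
proof -
  have stage: "|jt_stage I X n| \<le>o r" for n
  proof (induction n)
    case 0
    show ?case using X by simp
  next
    case (Suc n)
    let ?G = "jt_stage I X n"
    have img: "|f ` ?G| \<le>o r" for f :: "'a \<Rightarrow> 'a"
      using card_of_image Suc ordLeq_transitive by blast
    have "|?G \<times> ?G| \<le>o r"
      using card_of_Times_ordLeq_infinite_Field[OF r(2) Suc Suc r(1)] .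
    then have prod: "|f ` (?G \<times> ?G)| \<le>o r" for f :: "'a \<times> 'a \<Rightarrow> 'a"
      using card_of_image ordLeq_transitive by blast
    show ?case
      unfolding jt_stage.simps
      by (intro card_of_Un_ordLeq_infinite_Field[OF r(2)] Suc img prod r(1))
  qed
  have "|UNIV :: nat set| \<le>o r"
    using r infinite_iff_card_of_nat card_of_Field_ordIso ordLeq_ordIso_trans by blast
  then have "|\<Union>n. jt_stage I X n| \<le>o r"
    using card_of_UNION_ordLeq_infinite_Field[OF r(2) r(1)] stage by blast
  then show ?thesis
    by (rule ordLeq_transitive[OF card_of_mono1[OF jt_gen_subset_stages]])
qed

lemma countable_jt_gen_singleton: "countable (jt_gen I {x})"
proof -
  have "|{x}| \<le>o natLeq"
    using countable_card_le_natLeq[of "{x}"] by simp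
  then have "|jt_gen I {x}| \<le>o natLeq"
    by (rule card_of_jt_gen_le[OF _ natLeq_Card_order]) (simp add: Field_natLeq)
  then show ?thesis
    by (simp add: countable_card_le_natLeq)
qed

text \<open>
  By well-founded induction, an element that its predecessors generate is redundant as a generator.
\<close>

lemma jt_gen_not_generated_by_predecessors:
  assumes wo: "well_order_on A r" and cl: "closed_under_ops UNIV jt_arity I A"
  shows "jt_gen I {b \<in> A. b \<notin> jt_gen I (underS r b)} = A"
    (is "jt_gen I ?K = A")
proof
  show "jt_gen I ?K \<subseteq> A"
    by (rule jt_gen_least) (use cl in auto)
  have wf: "wf (r - Id)"
    using wo unfolding well_order_on_def by blast
  have sub: "underS r b \<subseteq> A" for b
    using well_order_on_Field[OF wo] unfolding underS_def by (auto intro: FieldI1)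
  show "A \<subseteq> jt_gen I ?K"
  proof
    fix b assume "b \<in> A"
    with wf show "b \<in> jt_gen I ?K"
    proof (induction b rule: wf_induct_rule)
      case (less b)
      show ?case
      proof (cases "b \<in> jt_gen I (underS r b)")
        case True
        have "underS r b \<subseteq> jt_gen I ?K"
          using less.IH sub unfolding underS_def by blast
        then show ?thesis
          using True jt_gen_least[OF _ closed_jt_gen] by blast
      next
        case False
        then show ?thesis
          using less.prems by (auto intro: jt_gen.base)
      qed
    qed
  qed
qed

text \<open>
  Zorn's lemma. The last property is what maximality is used for: every element of \<open>A\<close> outside
  \<open>S\<close> helps \<open>S\<close> to generate \<open>b\<close>, so it retains a trace of \<open>b\<close>.
\<close>

lemma maximal_closed_avoiding:
  assumes b: "b \<in> A" "b \<notin> jt_gen I C" and C: "C \<subseteq> A"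
    and cl: "closed_under_ops UNIV jt_arity I A"
  obtains S where "closed_under_ops UNIV jt_arity I S" "C \<subseteq> S" "S \<subseteq> A" "b \<notin> S"
    "\<And>x. x \<in> A \<Longrightarrow> x \<notin> S \<Longrightarrow> b \<in> jt_gen I (S \<union> {x})"
proof -
  define F where
    "F = {S. closed_under_ops UNIV jt_arity I S \<and> C \<subseteq> S \<and> S \<subseteq> A \<and> b \<notin> S}"
  have start: "jt_gen I C \<in> F"
    using b(2) jt_gen_least[OF C cl] closed_jt_gen[of I C] unfolding F_def
    by (auto intro: jt_gen.base)
  have chain: "\<Union>\<C> \<in> F" if ne: "\<C> \<noteq> {}" and ch: "subset.chain F \<C>" for \<C>
  proof -
    have sub: "\<C> \<subseteq> F" and lin: "\<And>S T. S \<in> \<C> \<Longrightarrow> T \<in> \<C> \<Longrightarrow> S \<subseteq> T \<or> T \<subseteq> S"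
      using ch unfolding subset_chain_def by auto
    have clS: "closed_under_ops UNIV jt_arity I S" if "S \<in> \<C>" for S
      using sub that unfolding F_def by blast
    have "closed_under_ops UNIV jt_arity I (\<Union>\<C>)"
      unfolding closed_under_jt_ops_iff
    proof (intro conjI ballI)
      fix x y assume "x \<in> \<Union>\<C>" "y \<in> \<Union>\<C>"
      then obtain S where S: "S \<in> \<C>" "x \<in> S" "y \<in> S"
        using lin by blast
      then show "I JT_mult [x, y] \<in> \<Union>\<C>"
        using clS unfolding closed_under_jt_ops_iff by blast
    next
      fix x assume "x \<in> \<Union>\<C>"
      then show "I JT_left [x] \<in> \<Union>\<C>" "I JT_right [x] \<in> \<Union>\<C>"
        using clS unfolding closed_under_jt_ops_iff by blast+
    qed
    then show ?thesis
      using sub ne unfolding F_def by blast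
  qed
  obtain S where S: "S \<in> F" and max: "\<And>T. T \<in> F \<Longrightarrow> S \<subseteq> T \<Longrightarrow> T = S"
    using subset_Zorn_nonempty[of F] start chain by blast
  have "b \<in> jt_gen I (S \<union> {x})" if x: "x \<in> A" "x \<notin> S" for x
  proof (rule ccontr)
    assume "b \<notin> jt_gen I (S \<union> {x})"
    moreover have "S \<union> {x} \<subseteq> jt_gen I (S \<union> {x})"
      by (auto intro: jt_gen.base)
    moreover have "jt_gen I (S \<union> {x}) \<subseteq> A"
      by (rule jt_gen_least) (use S x(1) cl in \<open>auto simp: F_def\<close>)
    ultimately have "jt_gen I (S \<union> {x}) = S"
      using S closed_jt_gen[of I "S \<union> {x}"] by (intro max) (auto simp: F_def)
    then show False
      using x(2) \<open>S \<union> {x} \<subseteq> jt_gen I (S \<union> {x})\<close> by blast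
  qed
  then show thesis
    using S that unfolding F_def by blast
qed

section \<open>Normal forms in Jonsson-Tarski algebras\<close>

inductive_set mult_closure :: "(jt_op \<Rightarrow> 'a list \<Rightarrow> 'a) \<Rightarrow> 'a set \<Rightarrow> 'a set"
  for I :: "jt_op \<Rightarrow> 'a list \<Rightarrow> 'a" and Y :: "'a set" where
  factor: "y \<in> Y \<Longrightarrow> y \<in> mult_closure I Y"
| mult: "u \<in> mult_closure I Y \<Longrightarrow> v \<in> mult_closure I Y \<Longrightarrow>
    I JT_mult [u, v] \<in> mult_closure I Y"

lemma jt_algebra_closed:
  "jonsson_tarski_algebra A I \<Longrightarrow> closed_under_ops UNIV jt_arity I A"
  by (simp add: jonsson_tarski_algebra_def is_algebra_def)

lemma mult_closure_subset:
  assumes "jonsson_tarski_algebra A I" "Y \<subseteq> A"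
  shows "mult_closure I Y \<subseteq> A"
proof
  fix z assume "z \<in> mult_closure I Y"
  then show "z \<in> A"
    using assms(2) jt_algebra_closed[OF assms(1)] unfolding closed_under_jt_ops_iff
    by induction auto
qed

text \<open>
  Applying \<open>\<ell>\<close> or \<open>r\<close> to an iterated product either removes the outermost product or, when
  there is none, acts on a single factor. Hence the iterated products of members of \<open>Y\<close> are
  already closed under all three operations.
\<close>

lemma jt_gen_subset_mult_closure:
  assumes jt: "jonsson_tarski_algebra A I" and Y: "Y \<subseteq> A"
    and unary: "\<And>y. y \<in> Y \<Longrightarrow> I JT_left [y] \<in> Y" "\<And>y. y \<in> Y \<Longrightarrow> I JT_right [y] \<in> Y"
  shows "jt_gen I Y \<subseteq> mult_closure I Y"
proof (rule jt_gen_least)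
  show "Y \<subseteq> mult_closure I Y"
    by (auto intro: mult_closure.factor)
  have "I JT_left [z] \<in> mult_closure I Y \<and> I JT_right [z] \<in> mult_closure I Y"
    if z: "z \<in> mult_closure I Y" for z
    using z
  proof cases
    case factor
    then show ?thesis
      using unary by (auto intro: mult_closure.factor)
  next
    case (mult u v)
    then have "u \<in> A" "v \<in> A"
      using mult_closure_subset[OF jt Y] by auto
    then have "I JT_left [z] = u" "I JT_right [z] = v"
      using jt mult(1) unfolding jonsson_tarski_algebra_def by auto
    then show ?thesis
      using mult by simp
  qed
  then show "closed_under_ops UNIV jt_arity I (mult_closure I Y)"
    unfolding closed_under_jt_ops_iff by (auto intro: mult_closure.mult)
qed

text \<open>
  The identities \<open>\<ell>(u \<cdot> v) = u\<close> and \<open>r(u \<cdot> v) = v\<close> put every factor of an iterated product into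
  the subalgebra generated by the product. If all factors were in the subalgebra \<open>S\<close>, the product
  would be as well.
\<close>

lemma factor_outside_subalgebra:
  assumes jt: "jonsson_tarski_algebra A I" and Y: "Y \<subseteq> A"
    and S: "closed_under_ops UNIV jt_arity I S"
    and z: "z \<in> mult_closure I Y" "z \<notin> S"
  shows "\<exists>y\<in>Y. y \<notin> S \<and> y \<in> jt_gen I {z}"
  using z
proof induction
  case (factor y)
  then show ?case
    by (auto intro: jt_gen.base)
next
  case (mult u v)
  let ?z = "I JT_mult [u, v]"
  have "u \<in> A" "v \<in> A"
    using mult.hyps mult_closure_subset[OF jt Y] by auto
  then have "I JT_left [?z] = u" "I JT_right [?z] = v"
    using jt unfolding jonsson_tarski_algebra_def by auto
  moreover have "I JT_left [?z] \<in> jt_gen I {?z}" "I JT_right [?z] \<in> jt_gen I {?z}"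
    by (auto intro: jt_gen.intros)
  ultimately have "{u} \<subseteq> jt_gen I {?z}" "{v} \<subseteq> jt_gen I {?z}"
    by simp_all
  then have sub: "jt_gen I {u} \<subseteq> jt_gen I {?z}" "jt_gen I {v} \<subseteq> jt_gen I {?z}"
    using jt_gen_least[OF _ closed_jt_gen] by blast+
  have "u \<notin> S \<or> v \<notin> S"
    using mult.prems S unfolding closed_under_jt_ops_iff by blast
  then show ?case
    using mult.IH sub by blast
qed

text \<open>
  The union of the subalgebras \<open>S\<close> and \<open>\<langle>x\<rangle>\<close> is closed under \<open>\<ell>\<close> and \<open>r\<close>, so \<open>b\<close> is an
  iterated product of its members; a factor of \<open>b\<close> outside \<open>S\<close> must come from \<open>\<langle>x\<rangle>\<close>.
\<close>

lemma jt_gen_meets_outside: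
  assumes jt: "jonsson_tarski_algebra A I"
    and S: "closed_under_ops UNIV jt_arity I S" "S \<subseteq> A"
    and x: "x \<in> A" and b: "b \<in> jt_gen I (S \<union> {x})" "b \<notin> S"
  shows "jt_gen I {x} \<inter> (jt_gen I {b} - S) \<noteq> {}"
proof -
  let ?Y = "S \<union> jt_gen I {x}"
  have YA: "?Y \<subseteq> A"
    using S(2) x jt_gen_least[of "{x}" A I] jt_algebra_closed[OF jt] by auto
  have "jt_gen I (S \<union> {x}) \<subseteq> jt_gen I ?Y"
    by (rule jt_gen_mono) (auto intro: jt_gen.base)
  also have "\<dots> \<subseteq> mult_closure I ?Y"
    by (rule jt_gen_subset_mult_closure[OF jt YA])
      (use S(1) in \<open>auto simp: closed_under_jt_ops_iff intro: jt_gen.intros\<close>)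
  finally have "b \<in> mult_closure I ?Y"
    using b(1) by blast
  then show ?thesis
    using factor_outside_subalgebra[OF jt YA S(1) _ b(2)] by blast
qed

section \<open>Jonsson algebras among Jonsson-Tarski algebras\<close>

theorem corollary2p9:
  fixes A :: "'a set" and I :: "jt_op \<Rightarrow> 'a list \<Rightarrow> 'a"
  assumes "jonsson_tarski_algebra A I"
  shows "\<not> (jonsson_algebra UNIV jt_arity A I \<and> aleph_one <o |A| )"
proof
  assume "jonsson_algebra UNIV jt_arity A I \<and> aleph_one <o |A|"
  then have jonsson: "jonsson_algebra UNIV jt_arity A I" and big: "aleph_one <o |A|"
    by auto
  note cl = jt_algebra_closed[OF assms]
  obtain r where wo: "well_order_on A r"
    using well_order_on by blast
  have sub: "underS r b \<subseteq> A" for b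
    using well_order_on_Field[OF wo] unfolding underS_def by (auto intro: FieldI1)
  define K where "K = {b \<in> A. b \<notin> jt_gen I (underS r b)}"

  have bigK: "aleph_one <o |K|"
  proof (rule ccontr)
    assume "\<not> aleph_one <o |K|"
    then have "|K| \<le>o aleph_one"
      using not_ordLeq_iff_ordLess[OF _ card_of_Well_order] Card_order_aleph_one
      unfolding card_order_on_def by blast
    then have "|jt_gen I K| \<le>o aleph_one"
      by (rule card_of_jt_gen_le[OF _ Card_order_aleph_one infinite_Field_aleph_one])
    then show False
      using jt_gen_not_generated_by_predecessors[OF wo cl] big not_ordLess_ordLeq
      unfolding K_def by auto
  qed

  have "\<exists>S. closed_under_ops UNIV jt_arity I S \<and> underS r b \<subseteq> S \<and> S \<subseteq> A \<and> b \<notin> S \<and>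
      (\<forall>x\<in>A. x \<notin> S \<longrightarrow> b \<in> jt_gen I (S \<union> {x}))" if "b \<in> K" for b
  proof -
    have b: "b \<in> A" "b \<notin> jt_gen I (underS r b)"
      using that unfolding K_def by auto
    show ?thesis
      by (rule maximal_closed_avoiding[OF b sub cl]) blast
  qed
  then have "\<exists>S. \<forall>b\<in>K. closed_under_ops UNIV jt_arity I (S b) \<and> underS r b \<subseteq> S b \<and>
      S b \<subseteq> A \<and> b \<notin> S b \<and> (\<forall>x\<in>A. x \<notin> S b \<longrightarrow> b \<in> jt_gen I (S b \<union> {x}))"
    by (intro bchoice ballI)
  then obtain S where max: "\<forall>b\<in>K. closed_under_ops UNIV jt_arity I (S b) \<and>
      underS r b \<subseteq> S b \<and> S b \<subseteq> A \<and> b \<notin> S b \<and>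
      (\<forall>x\<in>A. x \<notin> S b \<longrightarrow> b \<in> jt_gen I (S b \<union> {x}))" ..
  have S:
    "closed_under_ops UNIV jt_arity I (S b)" "underS r b \<subseteq> S b" "S b \<subseteq> A" "b \<notin> S b"
    "\<And>x. x \<in> A \<Longrightarrow> x \<notin> S b \<Longrightarrow> b \<in> jt_gen I (S b \<union> {x})" if "b \<in> K" for b
    using bspec[OF max that] by simp_all

  have small: "|S b| <o |A|" if b: "b \<in> K" for b
  proof -
    have "is_subalgebra UNIV jt_arity A I (S b)" "S b \<noteq> A"
      using S(1,3,4)[OF b] b unfolding is_subalgebra_def K_def by auto
    then have "\<not> |S b| =o |A|"
      using jonsson unfolding jonsson_algebra_def by blast
    then show ?thesis
      using card_of_mono1[OF S(3)[OF b]] ordLeq_iff_ordLess_or_ordIso by blast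
  qed

  obtain x where x: "x \<in> A" "uncountable {b \<in> K. x \<notin> S b}"
    by (rule point_missing_from_uncountably_many[OF big bigK small])

  define y where "y b = (SOME z. z \<in> jt_gen I {x} \<inter> (jt_gen I {b} - S b))" for b
  have y: "y b \<in> jt_gen I {x} \<inter> (jt_gen I {b} - S b)" if b: "b \<in> K" "x \<notin> S b" for b
    using jt_gen_meets_outside[OF assms S(1,3)[OF b(1)] x(1) S(5)[OF b(1) x(1) b(2)] S(4)[OF b(1)]]
    unfolding y_def some_in_eq .
  have swallow: "jt_gen I {b} \<subseteq> S c" if "c \<in> K" "b \<in> underS r c" for b c
    using jt_gen_least[of "{b}" "S c" I] S(1,2)[OF that(1)] that(2) by blast
  have "inj_on y {b \<in> K. x \<notin> S b}"
  proof (rule inj_onI, rule ccontr)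
    fix b c assume b: "b \<in> {b \<in> K. x \<notin> S b}" and c: "c \<in> {b \<in> K. x \<notin> S b}"
      and eq: "y b = y c" and ne: "b \<noteq> c"
    have "b \<in> A" "c \<in> A"
      using b c unfolding K_def by auto
    then have "b \<in> underS r c \<or> c \<in> underS r b"
      using wo ne unfolding well_order_on_def linear_order_on_def total_on_def underS_def
      by auto
    moreover have "y b \<in> jt_gen I {b}" "y b \<notin> S b" "y b \<in> jt_gen I {c}" "y b \<notin> S c"
      using y[of b] y[of c] b c eq by auto
    ultimately show False
      using swallow[of c b] swallow[of b c] b c by blast
  qed
  moreover have "y ` {b \<in> K. x \<notin> S b} \<subseteq> jt_gen I {x}"
    using y by blast
  ultimately have "countable {b \<in> K. x \<notin> S b}"
    using countable_subset[OF _ countable_jt_gen_singleton[of I x]] countable_image_inj_on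
    by blast
  with x(2) show False
    by blast
qed

end
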